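(* Let $X \subseteq \mathbb{R}^d$ be a non-empty bounded set. Then \[ \overline{\dim}_{\mathrm{B}} X =\inf\left\{ \beta \geq 0 : \exists\, c>0 \text{ such that } \inf_{\mu} \int_{|z| \leq R} |\widehat \mu (z)|^{2} \, dz \geq c\, R^{d-\beta} \text{ for all } R\geq 1 \right\} \] and \[ \underline{\dim}_{\mathrm{B}} X =\sup\left\{ \beta \geq 0 : \exists\, c>0 \text{ such that } \inf_{\mu} \int_{|z| \leq R} |\widehat \mu (z)|^{2} \, dz \leq c\, R^{d-\beta} \text{ for all } R\geq 1 \right\}, \] where in both formulae the infimum is over all Borel probability measures $\mu$ on $\mathbb{R}^d$ with $\mathrm{spt}(\mu) \subseteq X$.
   Context: The Fourier transform of a finite Borel measure $\mu$ on $\mathbb{R}^d$ is $\widehat \mu(z) = \int e^{-2\pi i z\cdot x}\, d\mu(x)$, and $\mathrm{spt}(\mu)$ denotes its support. For a bounded set $X\subseteq \mathbb{R}^d$ and $r>0$, $N_r(X)$ denotes the minimum number of sets of diameter $r$ needed to cover $X$. The upper and lower box dimensions of $X$ are \[ \overline{\dim}_{\mathrm{B}} X = \inf \{ \beta \geq 0 : \exists\, c>0,\ N_r(X) \leq c\, r^{-\beta} \text{ for all } r\in(0,1)\}, \] \[ \underline{\dim}_{\mathrm{B}} X = \sup \{ \beta \geq 0 : \exists\, c>0,\ N_r(X) \geq c\, r^{-\beta} \text{ for all } r\in(0,1)\}. \] *)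

theory Defs
  imports "HOL-Probability.Probability"
begin

definition measure_fourier :: "'a::euclidean_space measure \<Rightarrow> 'a \<Rightarrow> complex" where
  "measure_fourier \<mu> z = (LINT x|\<mu>. exp (- 2 * of_real pi * \<i> * of_real (z \<bullet> x)))"

definition spt :: "'a::topological_space measure \<Rightarrow> 'a set" where
  "spt \<mu> = {x. \<forall>U. open U \<and> x \<in> U \<longrightarrow> emeasure \<mu> U > 0}"

definition borel_probs_on :: "'a::topological_space set \<Rightarrow> 'a measure set" where
  "borel_probs_on X = {\<mu>. sets \<mu> = sets borel \<and> prob_space \<mu> \<and> spt \<mu> \<subseteq> X}"

(* Boundedness of the covering sets is required explicitly because diameter, being a real
   supremum, is an unspecified number on unbounded sets.  For bounded X in a Euclidean space and
   r > 0 a finite cover exists, so the LEAST is attained. *)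
definition covering_number :: "real \<Rightarrow> 'a::metric_space set \<Rightarrow> nat" where
  "covering_number r X =
     (LEAST n. \<exists>\<C>. finite \<C> \<and> card \<C> = n \<and>
        (\<forall>U\<in>\<C>. bounded U \<and> diameter U = r) \<and> X \<subseteq> \<Union>\<C>)"

(* For non-empty bounded X in a d-dimensional Euclidean space, the set in the upper dimension
   contains d, while that in the lower dimension contains 0 and is bounded above by d; so the
   real-valued Inf and Sup are the intended ones. *)
definition upper_box_dim :: "'a::metric_space set \<Rightarrow> real" where
  "upper_box_dim X =
     Inf {\<beta>. \<beta> \<ge> 0 \<and>
       (\<exists>c>0. \<forall>r\<in>{0<..<1}. real (covering_number r X) \<le> c * r powr (- \<beta>))}"

definition lower_box_dim :: "'a::metric_space set \<Rightarrow> real" where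
  "lower_box_dim X =
     Sup {\<beta>. \<beta> \<ge> 0 \<and>
       (\<exists>c>0. \<forall>r\<in>{0<..<1}. real (covering_number r X) \<ge> c * r powr (- \<beta>))}"

end

theory Submission
  imports Defs
begin

text \<open>
Write \<open>d\<close> for the dimension, \<open>N r\<close> for the covering number of \<open>X\<close>, \<open>I \<mu> R\<close> for the integral of
\<open>|\<mu>^|\<^sup>2\<close> over the ball of radius \<open>R\<close>, where \<open>\<mu>^\<close> is the Fourier transform of \<open>\<mu>\<close>, and \<open>J R\<close> for
the infimum of \<open>I \<mu> R\<close> over the admissible measures. The theorem holds because \<open>J R\<close> is comparable
to \<open>R ^ d / N (1 / R)\<close>, up to constant factors, also in the scale of \<open>N\<close>: there are constants \<open>c, C > 0\<close> with
\<open>c * R ^ d \<le> N (1 / (3 * R)) * J R\<close> and \<open>N (2 * d / R) * J R \<le> C * R ^ d\<close> for every \<open>R > 0\<close>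
(lemma \<open>min_fourier_energy_covering_number\<close>). Given this, a power bound on \<open>N\<close> with exponent \<open>\<beta>\<close> and
the corresponding power bound on \<open>J\<close> with exponent \<open>d - \<beta>\<close> are equivalent, so the sets of \<open>\<beta>\<close> on the
two sides of each formula are equal.

Both inequalities come from one identity. For probability measures \<open>\<mu>\<close> and \<open>\<nu>\<close>, Fubini's theorem gives
that the average of \<open>|\<mu>^ (u - v)|\<^sup>2\<close> over independent \<open>\<nu>\<close>-distributed \<open>u, v\<close> is the average of
\<open>|\<nu>^ (x - y)|\<^sup>2\<close> over independent \<open>\<mu>\<close>-distributed \<open>x, y\<close> (lemma \<open>fourier_energy_duality\<close>). Take for \<open>\<nu>\<close>
the uniform distribution on a cube centred at \<open>0\<close> whose side is a constant multiple of \<open>R\<close>. The first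
average is then at most a constant times \<open>I \<mu> R / R ^ d\<close> for the side \<open>R / d\<close>, and at least a constant
times it for the side \<open>4 * R\<close>. The second average is an energy of \<open>\<mu>\<close> with respect to the Fejer kernel
\<open>|\<nu>^|\<^sup>2\<close>. This kernel is non-negative; for the smaller cube it is at least \<open>1/4\<close> at distance up to
\<open>1 / (3 * R)\<close>; and for the larger one it is at most \<open>\<Prod>b. min 1 (1 / (R * x\<^sub>b)\<^sup>2)\<close>, the product being over
the coordinates.

For the lower bound of \<open>J\<close>, cover \<open>X\<close> by \<open>n\<close> sets of diameter \<open>1 / (3 * R)\<close>. By the Cauchy-Schwarz
inequality, two independent points fall into a common set of the cover with probability at least
\<open>1 / n\<close>, so the Fejer energy of every admissible \<open>\<mu>\<close> is at least \<open>1 / (4 * n)\<close>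
(lemma \<open>fourier_energy_ge_covering_number\<close>).

For the upper bound, choose one point of \<open>X\<close> in each of the cells of a grid of side \<open>1 / R\<close> that meet \<open>X\<close>, and
let \<open>\<mu>\<close> be the uniform distribution on these \<open>M\<close> points. By the decay of the kernel, the sum over all
points \<open>y\<close> of \<open>|\<nu>^ (x - y)|\<^sup>2\<close> is bounded independently of \<open>x\<close>, \<open>R\<close> and the points, so the Fejer
energy of \<open>\<mu>\<close> is \<open>O(1 / M)\<close>; and \<open>M\<close> balls centred at these points cover \<open>X\<close>
(lemma \<open>exists_fourier_energy_le_covering_number\<close>).
\<close>

section \<open>Characters and the duality of Fourier energies\<close>

definition character :: "'a::euclidean_space \<Rightarrow> 'a \<Rightarrow> complex" where
  "character z x = exp (- 2 * of_real pi * \<i> * of_real (z \<bullet> x))"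

lemma norm_character [simp]: "norm (character z x) = 1"
  by (simp add: character_def norm_exp_eq_Re)

lemma character_diff: "character z (x - y) = character z x * cnj (character z y)"
  by (simp add: character_def inner_diff_right algebra_simps exp_add [symmetric] exp_cnj)

lemma character_commute: "character z x = character x z"
  by (simp add: character_def inner_commute)

lemma Re_character: "Re (character z x) = cos (2 * pi * (z \<bullet> x))"
  by (simp add: character_def Re_exp)

lemma borel_measurable_character [measurable (raw)]:
  assumes [measurable]: "f \<in> borel_measurable M" "g \<in> borel_measurable M"
  shows "(\<lambda>x. character (f x) (g x)) \<in> borel_measurable M"
  unfolding character_def by measurable

lemma measure_fourier_character: "measure_fourier \<mu> z = (LINT x|\<mu>. character z x)"
  by (simp add: measure_fourier_def character_def)

lemma integrable_character:
  assumes "prob_space M" and [measurable]: "f \<in> borel_measurable M" "g \<in> borel_measurable M"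
  shows "integrable M (\<lambda>x. character (f x) (g x))"
proof -
  interpret prob_space M by fact
  show ?thesis by (rule integrable_const_bound [where B = 1]) auto
qed

lemma norm_measure_fourier_le_1:
  assumes "prob_space \<mu>" and s[measurable_cong]: "sets \<mu> = sets borel"
  shows "norm (measure_fourier \<mu> z) \<le> 1"
proof -
  interpret prob_space \<mu> by fact
  have "norm (measure_fourier \<mu> z) \<le> (LINT x|\<mu>. norm (character z x))"
    unfolding measure_fourier_character by (rule integral_norm_bound)
  then show ?thesis by (simp add: prob_space)
qed

lemma borel_measurable_measure_fourier:
  assumes "prob_space \<mu>" and s[measurable_cong]: "sets \<mu> = sets borel"
  shows "measure_fourier \<mu> \<in> borel_measurable borel"
proof -
  interpret prob_space \<mu> by fact
  show ?thesis unfolding measure_fourier_character [abs_def] by measurable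
qed

text \<open>
The square of the modulus is the Fourier transform of the law of \<open>x - y\<close> for independent \<open>x, y\<close>
distributed as \<open>\<mu>\<close>.
\<close>

lemma norm_measure_fourier_squared:
  fixes \<mu> :: "'a::euclidean_space measure"
  assumes "prob_space \<mu>" and s[measurable_cong]: "sets \<mu> = sets borel"
  shows "complex_of_real ((norm (measure_fourier \<mu> z))\<^sup>2) =
    (LINT q|(\<mu> \<Otimes>\<^sub>M \<mu>). character z (fst q - snd q))"
proof -
  interpret prob_space \<mu> by fact
  interpret pair: pair_prob_space \<mu> \<mu> ..
  have "(LINT q|(\<mu> \<Otimes>\<^sub>M \<mu>). character z (fst q - snd q))
      = (LINT x|\<mu>. LINT y|\<mu>. character z (x - y))"
    by (subst pair.integral_fst' [symmetric])
      (auto intro!: integrable_character pair.prob_space_axioms)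
  also have "\<dots> = measure_fourier \<mu> z * cnj (measure_fourier \<mu> z)"
    by (simp add: character_diff measure_fourier_character flip: integral_cnj)
  finally show ?thesis by (simp only: complex_norm_square)
qed

text \<open>
After expanding \<open>|\<mu>^|\<^sup>2\<close>, both sides are the integral of the character of \<open>(u - v) \<bullet> (x - y)\<close> over
\<open>(u, v)\<close> and \<open>(x, y)\<close>, taken in the two possible orders; the character is symmetric in its two arguments.
\<close>

lemma fourier_energy_duality:
  fixes \<mu> \<nu> :: "'a::euclidean_space measure"
  assumes \<mu>: "prob_space \<mu>" and s[measurable_cong]: "sets \<mu> = sets borel"
    and \<nu>: "prob_space \<nu>" and t[measurable_cong]: "sets \<nu> = sets borel"
  shows "(LINT p|(\<nu> \<Otimes>\<^sub>M \<nu>). (norm (measure_fourier \<mu> (fst p - snd p)))\<^sup>2)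
       = (LINT q|(\<mu> \<Otimes>\<^sub>M \<mu>). (norm (measure_fourier \<nu> (fst q - snd q)))\<^sup>2)"
proof -
  interpret M: prob_space \<mu> by fact
  interpret N: prob_space \<nu> by fact
  interpret MM: pair_prob_space \<mu> \<mu> ..
  interpret NN: pair_prob_space \<nu> \<nu> ..
  interpret pair: pair_prob_space "\<nu> \<Otimes>\<^sub>M \<nu>" "\<mu> \<Otimes>\<^sub>M \<mu>" ..
  have "complex_of_real (LINT p|(\<nu> \<Otimes>\<^sub>M \<nu>). (norm (measure_fourier \<mu> (fst p - snd p)))\<^sup>2)
      = (LINT p|(\<nu> \<Otimes>\<^sub>M \<nu>). LINT q|(\<mu> \<Otimes>\<^sub>M \<mu>). character (fst p - snd p) (fst q - snd q))"
    unfolding norm_measure_fourier_squared [OF \<mu> s, symmetric]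
    by (rule integral_complex_of_real [symmetric])
  also have "\<dots> = (LINT q|(\<mu> \<Otimes>\<^sub>M \<mu>). LINT p|(\<nu> \<Otimes>\<^sub>M \<nu>). character (fst p - snd p) (fst q - snd q))"
    by (rule pair.Fubini_integral [symmetric], unfold case_prod_beta)
      (intro integrable_character pair.prob_space_axioms; measurable)
  also have "\<dots> = (LINT q|(\<mu> \<Otimes>\<^sub>M \<mu>). LINT p|(\<nu> \<Otimes>\<^sub>M \<nu>). character (fst q - snd q) (fst p - snd p))"
    by (intro Bochner_Integration.integral_cong refl character_commute)
  also have "\<dots> = complex_of_real (LINT q|(\<mu> \<Otimes>\<^sub>M \<mu>). (norm (measure_fourier \<nu> (fst q - snd q)))\<^sup>2)"
    unfolding norm_measure_fourier_squared [OF \<nu> t, symmetric]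
    by (rule integral_complex_of_real)
  finally show ?thesis by (simp only: of_real_eq_iff)
qed

section \<open>The uniform distribution on a cube\<close>

definition cube :: "real \<Rightarrow> 'a::euclidean_space set" where
  "cube h = cbox (- (h *\<^sub>R One)) (h *\<^sub>R One)"

lemma mem_cube: "x \<in> cube h \<longleftrightarrow> (\<forall>b\<in>Basis. \<bar>x \<bullet> b\<bar> \<le> h)"
  by (auto simp: cube_def mem_box abs_le_iff minus_le_iff)

lemma sets_cube [measurable]: "cube h \<in> sets borel"
  by (simp add: cube_def)

lemma emeasure_cube:
  fixes h :: real
  assumes "0 < h"
  shows "emeasure lborel (cube h :: 'a::euclidean_space set) = ennreal ((2 * h) ^ DIM('a))"
  using assms unfolding cube_def
  by (subst emeasure_lborel_cbox) (auto simp: inner_add_left inner_diff_left)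

definition cube_measure :: "real \<Rightarrow> 'a::euclidean_space measure" where
  "cube_measure h = uniform_measure lborel (cube h)"

lemma sets_cube_measure [measurable_cong, simp]: "sets (cube_measure h) = sets borel"
  by (simp add: cube_measure_def)

lemma prob_space_cube_measure:
  "0 < h \<Longrightarrow> prob_space (cube_measure h :: 'a::euclidean_space measure)"
  unfolding cube_measure_def by (rule prob_space_uniform_measure) (auto simp: emeasure_cube)

lemma integral_cube_measure:
  fixes f :: "'a::euclidean_space \<Rightarrow> 'b::{banach, second_countable_topology}" and h :: real
  assumes "0 < h" and [measurable]: "f \<in> borel_measurable borel"
  shows "(LINT x|cube_measure h. f x)
    = (LINT x|lborel. (indicator (cube h) x / (2 * h) ^ DIM('a)) *\<^sub>R f x)"
proof -
  have "cube_measure h =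
      density lborel (\<lambda>x::'a. ennreal (indicator (cube h) x / (2 * h) ^ DIM('a)))"
    unfolding cube_measure_def uniform_measure_def emeasure_cube [OF \<open>0 < h\<close>]
    using \<open>0 < h\<close> divide_ennreal [of 1 "(2 * h) ^ DIM('a)"]
    by (intro density_cong) (auto split: split_indicator)
  moreover have "AE x::'a in lborel. 0 \<le> indicator (cube h) x / (2 * h) ^ DIM('a)"
    using \<open>0 < h\<close> by (auto split: split_indicator)
  ultimately show ?thesis
    by (simp add: integral_density)
qed

text \<open>
Lebesgue measure is the image of a product of one-dimensional Lebesgue measures.
\<close>

lemma integral_lborel_prod:
  fixes f :: "'a::euclidean_space \<Rightarrow> real \<Rightarrow> complex"
  assumes "\<And>b. b \<in> Basis \<Longrightarrow> integrable lborel (f b)"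
  shows "(LINT x|lborel. (\<Prod>b\<in>Basis. f b (x \<bullet> b))) = (\<Prod>b\<in>Basis. (LINT t|lborel. f b t))"
proof -
  interpret product_sigma_finite "\<lambda>_::'a. lborel :: real measure" ..
  have [measurable]: "f b \<in> borel_measurable borel" if "b \<in> Basis" for b
    using borel_measurable_integrable [OF assms [OF that]] by simp
  have "(LINT x|lborel. (\<Prod>b\<in>Basis. f b (x \<bullet> b)))
      = (LINT x|(Pi\<^sub>M Basis (\<lambda>b::'a. lborel)). (\<Prod>b\<in>Basis. f b ((\<Sum>c\<in>Basis. x c *\<^sub>R c) \<bullet> b)))"
    unfolding lborel_def [where 'a = 'a] lborel_eq_real [symmetric] by (subst integral_distr) auto
  also have "\<dots> = (LINT x|(Pi\<^sub>M Basis (\<lambda>b::'a. lborel)). (\<Prod>b\<in>Basis. f b (x b)))"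
    by (intro Bochner_Integration.integral_cong prod.cong refl) simp
  also have "\<dots> = (\<Prod>b\<in>Basis. (LINT t|lborel. f b t))"
    by (rule product_integral_prod) (use assms in auto)
  finally show ?thesis .
qed

text \<open>
Translation invariance of Lebesgue measure, in the form that exposes, for a fixed \<open>v\<close>, which region of
\<open>z = u - v\<close> is covered when \<open>u\<close> runs through the cube.
\<close>

lemma integral_cube_measure_translate:
  fixes F :: "'a::euclidean_space \<Rightarrow> real" and h :: real
  assumes "0 < h" and [measurable]: "F \<in> borel_measurable borel"
  shows "(LINT u|cube_measure h. F (u - v))
    = (LINT z|lborel. indicator (cube h) (z + v) * F z) / (2 * h) ^ DIM('a)"
proof -
  have "(LINT u|cube_measure h. F (u - v))
      = (LINT u|lborel. (indicator (cube h) u / (2 * h) ^ DIM('a)) * F (u - v))"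
    using \<open>0 < h\<close> by (subst integral_cube_measure) auto
  also have "\<dots> = (LINT u|distr lborel borel ((+) v).
      (indicator (cube h) u / (2 * h) ^ DIM('a)) * F (u - v))"
    by (simp only: lborel_distr_plus)
  also have "\<dots> = (LINT z|lborel. (indicator (cube h) (v + z) * F z) / (2 * h) ^ DIM('a))"
    by (subst integral_distr) auto
  finally show ?thesis by (simp add: add.commute)
qed

lemma integrable_indicator_times_bounded:
  fixes F :: "'a::euclidean_space \<Rightarrow> real"
  assumes [measurable]: "F \<in> borel_measurable borel" and F: "\<And>z. 0 \<le> F z" "\<And>z. F z \<le> 1"
    and [measurable]: "S \<in> sets borel" and "bounded S"
  shows "integrable lborel (\<lambda>z. indicator S z * F z)"
proof (rule Bochner_Integration.integrable_bound)
  have "emeasure lborel S < \<infinity>"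
    using \<open>bounded S\<close> by (rule emeasure_bounded_finite)
  then show "integrable lborel (indicator S :: 'a \<Rightarrow> real)"
    by (simp add: integrable_indicator_iff)
qed (use F in \<open>auto split: split_indicator\<close>)

lemma integrable_shifted_cube:
  fixes F :: "'a::euclidean_space \<Rightarrow> real" and h :: real
  assumes "F \<in> borel_measurable borel" and "\<And>z. 0 \<le> F z" "\<And>z. F z \<le> 1"
  shows "integrable lborel (\<lambda>z. indicator (cube h) (z + v) * F z)"
proof -
  have eq: "{z. z + v \<in> cube h} = (\<lambda>x. x - v) ` cube h"
    by (auto simp: image_iff intro!: bexI [of _ "_ + v"])
  have "bounded {z. z + v \<in> cube h}"
    unfolding eq by (intro bounded_translation_minus) (simp add: cube_def)
  moreover have "{z. z + v \<in> cube h} \<in> sets borel"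
    by measurable
  ultimately have "integrable lborel (\<lambda>z. indicator {z. z + v \<in> cube h} z * F z)"
    using assms by (intro integrable_indicator_times_bounded)
  then show ?thesis by (simp add: indicator_def)
qed

lemma AE_cube_measure: "0 < h \<Longrightarrow> AE v in cube_measure h. v \<in> cube h"
  unfolding cube_measure_def by (rule AE_uniform_measureI) auto

text \<open>
A difference of two points of the cube lies in the ball. So for each \<open>v\<close> in the cube the average over
\<open>u\<close> only sees values of \<open>F\<close> inside the ball, with density \<open>1 / (2 * h) ^ d\<close>.
\<close>

lemma cube_measure_difference_le_ball:
  fixes F :: "'a::euclidean_space \<Rightarrow> real" and h R :: real
  assumes h: "0 < h" and R: "2 * h * DIM('a) \<le> R"
    and [measurable]: "F \<in> borel_measurable borel" and F: "\<And>z. 0 \<le> F z" "\<And>z. F z \<le> 1"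
  shows "(\<integral>p. F (fst p - snd p) \<partial>(cube_measure h \<Otimes>\<^sub>M cube_measure h))
    \<le> (LINT z:cball 0 R|lborel. F z) / (2 * h) ^ DIM('a)"
proof -
  interpret N: prob_space "cube_measure h :: 'a measure"
    by (rule prob_space_cube_measure [OF h])
  interpret NN: pair_prob_space "cube_measure h :: 'a measure" "cube_measure h :: 'a measure" ..
  have int: "integrable (cube_measure h \<Otimes>\<^sub>M cube_measure h) (\<lambda>p::'a \<times> 'a. F (fst p - snd p))"
    by (rule NN.integrable_const_bound [where B = 1]) (use F in auto)
  have "(\<integral>p. F (fst p - snd p) \<partial>(cube_measure h \<Otimes>\<^sub>M cube_measure h))
      = (LINT v|cube_measure h. LINT u|cube_measure h. F (u - v))"
    using NN.integral_snd [of "\<lambda>u v. F (u - v)"] int by (simp add: case_prod_beta')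
  also have "\<dots> \<le> (LINT v|(cube_measure h :: 'a measure). (LINT z:cball 0 R|lborel. F z) / (2 * h) ^ DIM('a))"
  proof (rule integral_mono_AE)
    show "integrable (cube_measure h) (\<lambda>v::'a. LINT u|cube_measure h. F (u - v))"
      using NN.integrable_snd [of "\<lambda>u v. F (u - v)"] int by (simp add: case_prod_beta')
    show "AE v in cube_measure h. (LINT u|cube_measure h. F (u - v))
      \<le> (LINT z:cball 0 R|lborel. F z) / (2 * h) ^ DIM('a)"
      using AE_cube_measure [OF h]
    proof eventually_elim
      fix v :: 'a assume v: "v \<in> cube h"
      have "z \<in> cball 0 R" if "z + v \<in> cube h" for z
      proof -
        have "\<bar>z \<bullet> b\<bar> \<le> 2 * h" if "b \<in> Basis" for b
          using bspec [OF v [unfolded mem_cube] that]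
            bspec [OF \<open>z + v \<in> cube h\<close> [unfolded mem_cube] that]
          by (simp add: inner_add_left)
        then have "(\<Sum>b\<in>Basis. \<bar>z \<bullet> b\<bar>) \<le> (\<Sum>b\<in>(Basis::'a set). 2 * h)"
          by (rule sum_mono)
        then show ?thesis
          using norm_le_l1 [of z] R by (simp add: mult.commute mult.left_commute)
      qed
      then have "(LINT z|lborel. indicator (cube h) (z + v) * F z)
          \<le> (LINT z|lborel. indicator (cball 0 R) z * F z)"
        using F by (intro integral_mono integrable_shifted_cube integrable_indicator_times_bounded)
          (auto split: split_indicator)
      then show "(LINT u|cube_measure h. F (u - v))
          \<le> (LINT z:cball 0 R|lborel. F z) / (2 * h) ^ DIM('a)"
        using h by (simp add: integral_cube_measure_translate [OF h, of F v] set_lebesgue_integral_def divide_right_mono)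
    qed
  qed simp
  finally show ?thesis by (simp add: N.prob_space)
qed

text \<open>
If \<open>v\<close> lies in the concentric cube of half the size, then the translates by \<open>v\<close> of all points of the
ball lie in the cube. Such \<open>v\<close> have probability \<open>2 ^ - d\<close>, and the density of \<open>u - v\<close> on the ball
is then \<open>(4 * R) ^ - d\<close>; hence the factor \<open>8\<close>.
\<close>

lemma ball_le_cube_measure_difference:
  fixes F :: "'a::euclidean_space \<Rightarrow> real" and R :: real
  assumes R: "0 < R"
    and [measurable]: "F \<in> borel_measurable borel" and F: "\<And>z. 0 \<le> F z" "\<And>z. F z \<le> 1"
  shows "(LINT z:cball 0 R|lborel. F z) / (8 * R) ^ DIM('a)
    \<le> (\<integral>p. F (fst p - snd p) \<partial>(cube_measure (2 * R) \<Otimes>\<^sub>M cube_measure (2 * R)))"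
proof -
  define h where "h = 2 * R"
  have h: "0 < h" using R by (simp add: h_def)
  interpret N: prob_space "cube_measure h :: 'a measure"
    by (rule prob_space_cube_measure [OF h])
  interpret NN: pair_prob_space "cube_measure h :: 'a measure" "cube_measure h :: 'a measure" ..
  let ?I = "(LINT z:cball 0 R|lborel. F z) / (2 * h) ^ DIM('a)"
  have int: "integrable (cube_measure h \<Otimes>\<^sub>M cube_measure h) (\<lambda>p::'a \<times> 'a. F (fst p - snd p))"
    by (rule NN.integrable_const_bound [where B = 1]) (use F in auto)
  have I: "0 \<le> ?I"
    using h F by (auto intro!: divide_nonneg_nonneg integral_nonneg simp: set_lebesgue_integral_def)
  have "cube R \<inter> cube h = (cube R :: 'a set)"
    using R by (force simp: mem_cube h_def)
  then have "measure (cube_measure h) (cube R :: 'a set) = (2 * R) ^ DIM('a) / (2 * h) ^ DIM('a)"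
    using R h by (simp add: cube_measure_def emeasure_cube measure_def Int_commute divide_ennreal
        del: power_mult_distrib)
  also have "\<dots> = 1 / 2 ^ DIM('a)"
    using R by (simp add: h_def power_one_over flip: power_divide)
  finally have "1 / 2 ^ DIM('a) * ?I = (LINT v|cube_measure h. indicator (cube R) (v::'a) * ?I)"
    by simp
  also have "\<dots> \<le> (LINT v|cube_measure h. LINT u|cube_measure h. F (u - v))"
  proof (rule integral_mono)
    show "integrable (cube_measure h) (\<lambda>v::'a. LINT u|cube_measure h. F (u - v))"
      using NN.integrable_snd [of "\<lambda>u v. F (u - v)"] int by (simp add: case_prod_beta')
    show "integrable (cube_measure h) (\<lambda>v::'a. indicator (cube R) v * ?I)"
      by (rule N.integrable_const_bound [where B = "\<bar>?I\<bar>"]) (auto split: split_indicator)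
    fix v :: 'a
    show "indicator (cube R) v * ?I \<le> (LINT u|cube_measure h. F (u - v))"
    proof (cases "v \<in> cube R")
      case True
      have "z + v \<in> cube h" if "z \<in> cball 0 R" for z
        unfolding mem_cube
      proof
        fix b :: 'a assume b: "b \<in> Basis"
        show "\<bar>(z + v) \<bullet> b\<bar> \<le> h"
          using bspec [OF True [unfolded mem_cube] b] Basis_le_norm [OF b, of z] that
          by (simp add: inner_add_left h_def)
      qed
      then have "(LINT z|lborel. indicator (cball 0 R) z * F z)
          \<le> (LINT z|lborel. indicator (cube h) (z + v) * F z)"
        using F by (intro integral_mono integrable_shifted_cube integrable_indicator_times_bounded)
          (auto split: split_indicator)
      then show ?thesis
        using h True by (simp add: integral_cube_measure_translate [OF h, of F v] set_lebesgue_integral_def divide_right_mono)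
    next
      case False
      then show ?thesis using F by simp
    qed
  qed
  also have "\<dots> = (\<integral>p. F (fst p - snd p) \<partial>(cube_measure h \<Otimes>\<^sub>M cube_measure h))"
    using NN.integral_snd [of "\<lambda>u v. F (u - v)"] int by (simp add: case_prod_beta')
  finally have "1 / 2 ^ DIM('a) * ?I \<le>
      (\<integral>p. F (fst p - snd p) \<partial>(cube_measure h \<Otimes>\<^sub>M cube_measure h))" .
  moreover have "(8 * R) ^ DIM('a) = (2 * (2 * h)) ^ DIM('a)"
    by (simp add: h_def)
  then have "(LINT z:cball 0 R|lborel. F z) / (8 * R) ^ DIM('a) = 1 / 2 ^ DIM('a) * ?I"
    by (simp only: power_mult_distrib [of 2 "2 * h"]) simp
  ultimately show ?thesis
    by (simp only: h_def)
qed

section \<open>Decay of the Fourier transform of the cube\<close>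

text \<open>
The function \<open>sin (2 * pi * h * s) / (2 * pi * h * s)\<close>, extended continuously to \<open>s = 0\<close>: the Fourier
transform of the uniform distribution on the interval \<open>{-h..h}\<close>.
\<close>

definition cube_factor :: "real \<Rightarrow> real \<Rightarrow> complex" where
  "cube_factor h s = (LINT t|lborel. indicator {-h..h} t *\<^sub>R (character s t / of_real (2 * h)))"

lemma norm_cube_factor_le_1:
  assumes "0 < h"
  shows "norm (cube_factor h s) \<le> 1"
proof -
  have "norm (cube_factor h s)
      \<le> (LINT t|lborel. norm (indicator {-h..h} t *\<^sub>R (character s t / of_real (2 * h))))"
    unfolding cube_factor_def by (rule integral_norm_bound)
  also have "\<dots> = (LINT t|lborel. indicator {-h..h} t * (1 / (2 * h)))"
    using assms by (intro Bochner_Integration.integral_cong) (auto simp: norm_divide split: split_indicator)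
  also have "\<dots> = 1"
    using assms by simp
  finally show ?thesis .
qed

lemma norm_cube_factor_le_inverse:
  assumes "0 < h" and "s \<noteq> 0"
  shows "norm (cube_factor h s) \<le> 1 / (2 * pi * h * \<bar>s\<bar>)"
proof -
  define c where "c = - 2 * of_real pi * \<i> * complex_of_real s"
  have c: "c \<noteq> 0" using \<open>s \<noteq> 0\<close> by (simp add: c_def)
  have char: "character s t = exp (c * of_real t)" for t
    by (simp add: character_def c_def mult.assoc)
  have "cube_factor h s = exp (c * of_real h) / (c * of_real (2 * h))
      - exp (c * of_real (- h)) / (c * of_real (2 * h))"
    unfolding cube_factor_def char
  proof (rule integral_FTC_Icc)
    show "continuous_on {-h..h} (\<lambda>t. exp (c * complex_of_real t) / of_real (2 * h))"
      using assms by (intro continuous_intros) auto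
    show "((\<lambda>t. exp (c * complex_of_real t) / (c * of_real (2 * h))) has_vector_derivative
        exp (c * complex_of_real t) / of_real (2 * h)) (at t within {-h..h})" for t
      using c assms
      by (auto intro!: derivative_eq_intros has_vector_derivative_real_field simp: field_simps)
  qed (use assms in auto)
  also have "norm \<dots> \<le> norm (exp (c * of_real h) / (c * of_real (2 * h)))
      + norm (exp (c * of_real (- h)) / (c * of_real (2 * h)))"
    by (rule norm_triangle_ineq4)
  also have "\<dots> = 1 / (2 * pi * h * \<bar>s\<bar>)"
    using assms by (simp add: c_def norm_divide norm_mult norm_exp_eq_Re field_simps)
  finally show ?thesis .
qed

lemma measure_fourier_cube_measure:
  fixes x :: "'a::euclidean_space" and h :: real
  assumes h: "0 < h"
  shows "measure_fourier (cube_measure h) x = (\<Prod>b\<in>Basis. cube_factor h (x \<bullet> b))"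
proof -
  let ?f = "\<lambda>b t. indicator {-h..h} t *\<^sub>R (character (x \<bullet> b) t / of_real (2 * h))"
  have "measure_fourier (cube_measure h) x
      = (LINT u|lborel. (indicator (cube h) u / (2 * h) ^ DIM('a)) *\<^sub>R character x u)"
    unfolding measure_fourier_character by (rule integral_cube_measure [OF h]) measurable
  also have "\<dots> = (LINT u|lborel. (\<Prod>b\<in>Basis. ?f b (u \<bullet> b)))"
  proof (rule Bochner_Integration.integral_cong [OF refl])
    fix u :: 'a
    have "character x u = (\<Prod>b\<in>Basis. character (x \<bullet> b) (u \<bullet> b))"
      unfolding character_def exp_sum [OF finite_Basis, symmetric]
      by (simp add: euclidean_inner [of x u] sum_distrib_left mult.commute)
    moreover have "indicator (cube h) u = (\<Prod>b\<in>Basis. indicator {-h..h} (u \<bullet> b) :: real)"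
      by (auto simp: indicator_def mem_cube abs_le_iff minus_le_iff)
    ultimately show "(indicator (cube h) u / (2 * h) ^ DIM('a)) *\<^sub>R character x u
        = (\<Prod>b\<in>Basis. ?f b (u \<bullet> b))"
      by (simp add: scaleR_conv_of_real prod.distrib prod_dividef)
  qed
  also have "\<dots> = (\<Prod>b\<in>Basis. cube_factor h (x \<bullet> b))"
    unfolding cube_factor_def
  proof (rule integral_lborel_prod)
    fix b :: 'a
    show "integrable lborel (?f b)"
      using h by (intro borel_integrable_compact [unfolded set_integrable_def])
        (auto intro!: continuous_intros simp: character_def)
  qed
  finally show ?thesis .
qed

text \<open>
Two reals whose integer parts are \<open>i\<close> and \<open>j\<close> differ by at least \<open>|i - j| - 1\<close>. The form
\<open>8 / (1 + (i - j)\<^sup>2)\<close> absorbs neighbouring and equal cells, where only the trivial bound \<open>1\<close> is available,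
into a single weight that is summable over the integers.
\<close>

lemma norm_cube_factor_decay:
  fixes i j :: int
  assumes R: "0 < R" and s: "\<bar>real_of_int (i - j)\<bar> - 1 \<le> R * \<bar>s\<bar>"
  shows "(norm (cube_factor (2 * R) s))\<^sup>2 \<le> 8 / (1 + (real_of_int (i - j))\<^sup>2)"
proof -
  define k where "k = \<bar>i - j\<bar>"
  have k: "0 \<le> k" "(real_of_int (i - j))\<^sup>2 = (real_of_int k)\<^sup>2" "real_of_int k - 1 \<le> R * \<bar>s\<bar>"
    using s by (simp_all add: k_def)
  show ?thesis
  proof (cases "k \<le> 1")
    case True
    then have "(real_of_int k)\<^sup>2 \<le> 1"
      using k(1) by (intro power_le_one) auto
    then have "1 \<le> 8 / (1 + (real_of_int k)\<^sup>2)"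
      by (subst le_divide_eq_1_pos) (simp_all add: add_pos_nonneg)
    moreover have "(norm (cube_factor (2 * R) s))\<^sup>2 \<le> 1"
      using norm_cube_factor_le_1 [of "2 * R" s] R by (intro power_le_one) auto
    ultimately show ?thesis by (simp only: k)
  next
    case False
    then have k2: "2 \<le> real_of_int k" by simp
    then have pos: "1 \<le> R * \<bar>s\<bar>" using k by simp
    then have s0: "s \<noteq> 0" by auto
    have "1 * (R * \<bar>s\<bar>) \<le> (4 * pi) * (R * \<bar>s\<bar>)"
      using pos pi_gt3 by (intro mult_right_mono) auto
    then have "real_of_int k - 1 \<le> 2 * pi * (2 * R) * \<bar>s\<bar>"
      using k(3) by (simp add: mult_ac)
    then have "1 / (2 * pi * (2 * R) * \<bar>s\<bar>) \<le> 1 / (real_of_int k - 1)"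
      using k2 by (intro divide_left_mono mult_pos_pos) (use R s0 in auto)
    then have "norm (cube_factor (2 * R) s) \<le> 1 / (real_of_int k - 1)"
      using norm_cube_factor_le_inverse [of "2 * R" s] R s0 by simp
    then have "(norm (cube_factor (2 * R) s))\<^sup>2 \<le> (1 / (real_of_int k - 1))\<^sup>2"
      by (rule power_mono) simp
    also have "\<dots> \<le> 8 / (1 + (real_of_int k)\<^sup>2)"
    proof -
      \<comment> \<open>The right-hand side is \<open>8 * (k - 1)\<^sup>2 - (1 + k\<^sup>2)\<close>, written so that its sign is visible for \<open>k \<ge> 2\<close>.\<close>
      have "0 \<le> (real_of_int k - 2) * (7 * real_of_int k - 2) + 3"
        using k2 by (intro add_nonneg_nonneg mult_nonneg_nonneg) auto
      then have "1 + (real_of_int k)\<^sup>2 \<le> 8 * (real_of_int k - 1)\<^sup>2"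
        by (simp add: power2_eq_square algebra_simps)
      moreover have "0 < 1 + (real_of_int k)\<^sup>2" "0 < (real_of_int k - 1)\<^sup>2"
        using k2 by (auto intro: add_pos_nonneg)
      ultimately show ?thesis by (simp add: power_divide divide_simps)
    qed
    finally show ?thesis by (simp only: k)
  qed
qed

lemma sum_lattice_weight_bounded:
  "\<exists>C::real>0. \<forall>i::int. \<forall>S::int set. finite S \<longrightarrow>
    (\<Sum>j\<in>S. 8 / (1 + (real_of_int (i - j))\<^sup>2)) \<le> C"
proof -
  define w :: "nat \<Rightarrow> real" where "w n = 8 / (1 + (real n)\<^sup>2)" for n
  have w0: "0 < w n" for n
    by (simp add: w_def add_pos_nonneg)
  have sw: "summable w"
  proof (rule summable_comparison_test_ev)
    show "summable (\<lambda>n. 8 * inverse (real n ^ 2))"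
      by (intro summable_mult inverse_power_summable) simp
    show "\<forall>\<^sub>F n in sequentially. norm (w n) \<le> 8 * inverse (real n ^ 2)"
      using eventually_gt_at_top [of 0]
      by eventually_elim (simp add: w_def field_simps add_pos_nonneg)
  qed
  \<comment> \<open>On either side of \<open>i\<close> the distance to \<open>i\<close> determines \<open>j\<close>, so the sum there is part of the series.\<close>
  have half: "(\<Sum>j\<in>T. 8 / (1 + (real_of_int (i - j))\<^sup>2)) \<le> suminf w"
    if "finite T" and inj: "inj_on (\<lambda>j. nat \<bar>i - j\<bar>) T" for i :: int and T
  proof -
    have "8 / (1 + (real_of_int (i - j))\<^sup>2) = w (nat \<bar>i - j\<bar>)" for j
      by (simp add: w_def)
    then have "(\<Sum>j\<in>T. 8 / (1 + (real_of_int (i - j))\<^sup>2)) = sum w ((\<lambda>j. nat \<bar>i - j\<bar>) ` T)"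
      by (simp add: sum.reindex [OF inj])
    also have "\<dots> \<le> suminf w"
      using sw \<open>finite T\<close> w0 by (intro sum_le_suminf) (auto intro: less_imp_le)
    finally show ?thesis .
  qed
  show ?thesis
  proof (intro exI [of _ "2 * suminf w"] conjI allI impI)
    show "0 < 2 * suminf w"
      using suminf_pos [OF sw w0] by simp
    fix i :: int and S :: "int set"
    assume S: "finite S"
    have "(\<Sum>j\<in>S. 8 / (1 + (real_of_int (i - j))\<^sup>2))
        = (\<Sum>j\<in>{j\<in>S. j \<le> i}. 8 / (1 + (real_of_int (i - j))\<^sup>2))
          + (\<Sum>j\<in>{j\<in>S. \<not> j \<le> i}. 8 / (1 + (real_of_int (i - j))\<^sup>2))"
      using S by (subst sum.union_disjoint [symmetric]) (auto intro!: sum.cong)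
    also have "\<dots> \<le> suminf w + suminf w"
      using S by (intro add_mono half) (auto simp: inj_on_def)
    finally show "(\<Sum>j\<in>S. 8 / (1 + (real_of_int (i - j))\<^sup>2)) \<le> 2 * suminf w"
      by simp
  qed
qed

text \<open>
The label, by its lower corner scaled by \<open>R\<close>, of the half-open cell of side \<open>1 / R\<close> that contains \<open>x\<close>. It
is made extensional on \<open>Basis\<close>, so that the labels of finitely many cells lie in a finite product set.
\<close>

definition grid_cell :: "real \<Rightarrow> 'a::euclidean_space \<Rightarrow> 'a \<Rightarrow> int" where
  "grid_cell R x = (\<lambda>b\<in>Basis. \<lfloor>R * (x \<bullet> b)\<rfloor>)"

text \<open>
The points of \<open>P\<close> are in distinct cells, so the sum over \<open>P\<close> is dominated by a sum of product weights over
cell labels. Extending it to a box of labels turns it into a product of \<open>d\<close> one-dimensional sums. The bound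
is uniform in \<open>R\<close> because cube and grid are scaled inversely to each other.
\<close>

lemma sum_fourier_cube_measure_bounded:
  "\<exists>C::real>0. \<forall>R>0. \<forall>(x::'a::euclidean_space) P. finite P \<and> inj_on (grid_cell R) P \<longrightarrow>
    (\<Sum>y\<in>P. (norm (measure_fourier (cube_measure (2 * R)) (x - y)))\<^sup>2) \<le> C"
proof -
  obtain C :: real where C: "0 < C"
    and sumC: "\<And>i S. finite S \<Longrightarrow> (\<Sum>j\<in>S. 8 / (1 + (real_of_int (i - j))\<^sup>2)) \<le> C"
    using sum_lattice_weight_bounded by blast
  show ?thesis
  proof (intro exI [of _ "C ^ DIM('a)"] conjI allI impI, use C in simp)
    fix R :: real and x :: 'a and P :: "'a set"
    assume R: "0 < R" and P: "finite P \<and> inj_on (grid_cell R) P"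
    define w :: "('a \<Rightarrow> int) \<Rightarrow> 'a \<Rightarrow> real"
      where "w k b = 8 / (1 + (real_of_int (\<lfloor>R * (x \<bullet> b)\<rfloor> - k b))\<^sup>2)" for k b
    have w0: "0 \<le> w k b" for k b
      by (simp add: w_def)
    define S where "S = (\<Union>y\<in>P. (\<lambda>b. \<lfloor>R * (y \<bullet> b)\<rfloor>) ` (Basis :: 'a set))"
    have S: "finite S" using P by (simp add: S_def)
    have decay: "(norm (measure_fourier (cube_measure (2 * R)) (x - y)))\<^sup>2
        \<le> (\<Prod>b\<in>Basis. w (grid_cell R y) b)" for y
    proof -
      have "(norm (measure_fourier (cube_measure (2 * R)) (x - y)))\<^sup>2
          = (\<Prod>b\<in>Basis. (norm (cube_factor (2 * R) ((x - y) \<bullet> b)))\<^sup>2)"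
        using R by (simp add: measure_fourier_cube_measure prod_norm [symmetric] prod_power_distrib)
      also have "\<dots> \<le> (\<Prod>b\<in>Basis. w (grid_cell R y) b)"
      proof (rule prod_mono)
        fix b :: 'a assume b: "b \<in> Basis"
        have "\<bar>real_of_int (\<lfloor>R * (x \<bullet> b)\<rfloor> - \<lfloor>R * (y \<bullet> b)\<rfloor>)\<bar> - 1
            \<le> \<bar>R * (x \<bullet> b) - R * (y \<bullet> b)\<bar>"
          by linarith
        also have "\<dots> = R * \<bar>(x - y) \<bullet> b\<bar>"
          using R by (simp add: inner_diff_left abs_mult flip: right_diff_distrib)
        finally show "0 \<le> (norm (cube_factor (2 * R) ((x - y) \<bullet> b)))\<^sup>2 \<and>
            (norm (cube_factor (2 * R) ((x - y) \<bullet> b)))\<^sup>2 \<le> w (grid_cell R y) b"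
          using norm_cube_factor_decay [OF R] b by (simp add: w_def grid_cell_def)
      qed
      finally show ?thesis .
    qed
    have "(\<Sum>y\<in>P. (norm (measure_fourier (cube_measure (2 * R)) (x - y)))\<^sup>2)
        \<le> (\<Sum>y\<in>P. \<Prod>b\<in>Basis. w (grid_cell R y) b)"
      by (intro sum_mono decay)
    also have "\<dots> = (\<Sum>k\<in>grid_cell R ` P. \<Prod>b\<in>Basis. w k b)"
      using P by (simp add: sum.reindex)
    also have "\<dots> \<le> (\<Sum>k\<in>PiE Basis (\<lambda>_. S). \<Prod>b\<in>Basis. w k b)"
      using P S w0 by (intro sum_mono2 finite_PiE prod_nonneg) (auto simp: grid_cell_def S_def)
    also have "\<dots> = (\<Prod>b\<in>Basis. \<Sum>j\<in>S. 8 / (1 + (real_of_int (\<lfloor>R * (x \<bullet> b)\<rfloor> - j))\<^sup>2))"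
      unfolding w_def using S by (subst prod_sum_PiE) auto
    also have "\<dots> \<le> (\<Prod>b\<in>(Basis::'a set). C)"
      using S sumC by (intro prod_mono conjI sum_nonneg) auto
    finally show "(\<Sum>y\<in>P. (norm (measure_fourier (cube_measure (2 * R)) (x - y)))\<^sup>2)
        \<le> C ^ DIM('a)"
      by simp
  qed
qed

section \<open>Measures of small energy\<close>

definition uniform_points :: "'a::euclidean_space set \<Rightarrow> 'a measure" where
  "uniform_points P = distr (uniform_count_measure P) borel (\<lambda>x. x)"

lemma sets_uniform_points [measurable_cong, simp]: "sets (uniform_points P) = sets borel"
  by (simp add: uniform_points_def)

lemma measurable_uniform_count_measure [measurable]:
  "(\<lambda>x. x) \<in> uniform_count_measure P \<rightarrow>\<^sub>M (borel :: 'a::topological_space measure)"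
  by (auto simp: measurable_def space_uniform_count_measure sets_uniform_count_measure)

lemma prob_space_uniform_points:
  assumes "finite P" "P \<noteq> {}"
  shows "prob_space (uniform_points P)"
  unfolding uniform_points_def
  by (intro prob_space.prob_space_distr prob_space_uniform_count_measure assms measurable_uniform_count_measure)

lemma integral_uniform_points:
  fixes f :: "'a::euclidean_space \<Rightarrow> real"
  assumes "finite P" and [measurable]: "f \<in> borel_measurable borel"
  shows "(LINT x|uniform_points P. f x) = sum f P / card P"
  unfolding uniform_points_def
  using assms by (subst integral_distr) (auto simp: integral_uniform_count_measure)

lemma spt_uniform_points:
  assumes "finite P"
  shows "spt (uniform_points P) \<subseteq> P"
proof
  fix x assume x: "x \<in> spt (uniform_points P)"
  show "x \<in> P"
  proof (rule ccontr)
    assume "x \<notin> P"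
    have "open (- P)"
      using \<open>finite P\<close> by (simp add: finite_imp_closed open_Compl)
    then have "emeasure (uniform_points P) (- P) > 0"
      using x \<open>x \<notin> P\<close> by (auto simp: spt_def)
    moreover have "emeasure (uniform_points P) (- P) = 0"
      using \<open>open (- P)\<close> unfolding uniform_points_def
      by (subst emeasure_distr) (auto simp: space_uniform_count_measure)
    ultimately show False by simp
  qed
qed

lemma uniform_points_in_borel_probs_on:
  assumes "finite P" "P \<noteq> {}" "P \<subseteq> X"
  shows "uniform_points P \<in> borel_probs_on X"
  using assms spt_uniform_points [of P] prob_space_uniform_points [of P]
  by (auto simp: borel_probs_on_def)

text \<open>
By duality the energy is \<open>1 / (card P)\<^sup>2\<close> times a double sum over \<open>P\<close>, whose inner sums are bounded.
\<close>

lemma fourier_energy_separated_points_le: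
  "\<exists>C::real>0. \<forall>R>0. \<forall>P::'a::euclidean_space set.
    finite P \<and> P \<noteq> {} \<and> inj_on (grid_cell R) P \<longrightarrow>
    (LINT z:cball 0 R|lborel. (norm (measure_fourier (uniform_points P) z))\<^sup>2) \<le> C * R ^ DIM('a) / card P"
proof -
  obtain C :: real where C: "0 < C" and sumC: "\<And>R (x::'a) P. 0 < R \<Longrightarrow> finite P \<Longrightarrow> inj_on (grid_cell R) P \<Longrightarrow>
      (\<Sum>y\<in>P. (norm (measure_fourier (cube_measure (2 * R)) (x - y)))\<^sup>2) \<le> C"
    using sum_fourier_cube_measure_bounded [where 'a = 'a] by blast
  show ?thesis
  proof (intro exI [of _ "C * 8 ^ DIM('a)"] conjI allI impI, use C in simp)
    fix R :: real and P :: "'a set"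
    assume R: "0 < R" and P: "finite P \<and> P \<noteq> {} \<and> inj_on (grid_cell R) P"
    define \<mu> where "\<mu> = uniform_points P"
    define \<nu> :: "'a measure" where "\<nu> = cube_measure (2 * R)"
    have \<mu>: "prob_space \<mu>" "sets \<mu> = sets borel"
      using P by (simp_all add: \<mu>_def prob_space_uniform_points)
    have \<nu>: "prob_space \<nu>" "sets \<nu> = sets borel"
      using R by (simp_all add: \<nu>_def prob_space_cube_measure)
    interpret M: prob_space \<mu> by fact
    interpret MM: pair_prob_space \<mu> \<mu> ..
    note [measurable] = borel_measurable_measure_fourier [OF \<mu>] borel_measurable_measure_fourier [OF \<nu>]
    note [measurable_cong] = \<mu>(2)
    have le1: "(norm (measure_fourier \<nu> z))\<^sup>2 \<le> 1" "(norm (measure_fourier \<mu> z))\<^sup>2 \<le> 1" for z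
      using norm_measure_fourier_le_1 [OF \<nu>] norm_measure_fourier_le_1 [OF \<mu>]
      by (auto intro!: power_le_one)
    have "(LINT z:cball 0 R|lborel. (norm (measure_fourier \<mu> z))\<^sup>2) / (8 * R) ^ DIM('a)
        \<le> (\<integral>p. (norm (measure_fourier \<mu> (fst p - snd p)))\<^sup>2 \<partial>(\<nu> \<Otimes>\<^sub>M \<nu>))"
      unfolding \<nu>_def using R le1 by (intro ball_le_cube_measure_difference) auto
    also have "\<dots> = (\<integral>q. (norm (measure_fourier \<nu> (fst q - snd q)))\<^sup>2 \<partial>(\<mu> \<Otimes>\<^sub>M \<mu>))"
      by (rule fourier_energy_duality [OF \<mu> \<nu>])
    also have "\<dots> = (LINT x|\<mu>. LINT y|\<mu>. (norm (measure_fourier \<nu> (x - y)))\<^sup>2)"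
    proof -
      have "integrable (\<mu> \<Otimes>\<^sub>M \<mu>) (\<lambda>q. (norm (measure_fourier \<nu> (fst q - snd q)))\<^sup>2)"
        by (rule MM.integrable_const_bound [where B = 1]) (use le1 in auto)
      from MM.integral_fst' [OF this] show ?thesis by simp
    qed
    also have "\<dots> = (\<Sum>x\<in>P. \<Sum>y\<in>P. (norm (measure_fourier \<nu> (x - y)))\<^sup>2) / (real (card P))\<^sup>2"
      unfolding \<mu>_def using P
      by (simp add: integral_uniform_points sum_divide_distrib power2_eq_square)
    also have "\<dots> \<le> (\<Sum>x\<in>P. C) / (real (card P))\<^sup>2"
      unfolding \<nu>_def using P R sumC by (intro divide_right_mono sum_mono) auto
    also have "\<dots> = C / card P"
      by (simp add: power2_eq_square)
    finally show "(LINT z:cball 0 R|lborel. (norm (measure_fourier (uniform_points P) z))\<^sup>2)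
        \<le> C * 8 ^ DIM('a) * R ^ DIM('a) / card P"
      using R by (simp add: \<mu>_def field_simps power_mult_distrib)
  qed
qed

section \<open>Covering numbers and grids\<close>

lemma norm_diff_le_if_same_grid_cell:
  fixes x y :: "'a::euclidean_space"
  assumes "0 < R" and eq: "grid_cell R x = grid_cell R y"
  shows "norm (x - y) \<le> DIM('a) / R"
proof -
  have "\<bar>(x - y) \<bullet> b\<bar> \<le> 1 / R" if b: "b \<in> Basis" for b
  proof -
    have "\<lfloor>R * (x \<bullet> b)\<rfloor> = \<lfloor>R * (y \<bullet> b)\<rfloor>"
      using fun_cong [OF eq, of b] b by (simp add: grid_cell_def)
    then have "\<bar>R * (x \<bullet> b) - R * (y \<bullet> b)\<bar> \<le> 1"
      by linarith
    then have "R * \<bar>(x - y) \<bullet> b\<bar> \<le> 1"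
      using \<open>0 < R\<close> by (simp add: inner_diff_left abs_mult flip: right_diff_distrib)
    then show ?thesis
      using \<open>0 < R\<close> by (simp add: field_simps)
  qed
  then have "(\<Sum>b\<in>Basis. \<bar>(x - y) \<bullet> b\<bar>) \<le> (\<Sum>b\<in>(Basis::'a set). 1 / R)"
    by (rule sum_mono)
  then show ?thesis
    using norm_le_l1 [of "x - y"] by simp
qed

lemma finite_grid_cell_image:
  fixes X :: "'a::euclidean_space set"
  assumes "0 < R" "bounded X"
  shows "finite (grid_cell R ` X)"
proof -
  obtain B where B: "\<And>x. x \<in> X \<Longrightarrow> norm x \<le> B"
    using \<open>bounded X\<close> by (auto simp: bounded_iff)
  have "grid_cell R ` X \<subseteq> PiE Basis (\<lambda>_. {\<lfloor>- (R * B)\<rfloor>..\<lfloor>R * B\<rfloor>})"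
  proof (intro image_subsetI PiE_I)
    fix x b :: 'a assume "x \<in> X" and b: "b \<in> Basis"
    then have "\<bar>x \<bullet> b\<bar> \<le> B"
      using B Basis_le_norm order_trans by blast
    then have "R * \<bar>x \<bullet> b\<bar> \<le> R * B"
      using \<open>0 < R\<close> by simp
    then have "\<bar>R * (x \<bullet> b)\<bar> \<le> R * B"
      using \<open>0 < R\<close> by (simp add: abs_mult)
    then show "grid_cell R x b \<in> {\<lfloor>- (R * B)\<rfloor>..\<lfloor>R * B\<rfloor>}"
      using b by (auto simp: grid_cell_def abs_le_iff intro!: floor_mono)
  qed (simp add: grid_cell_def)
  then show ?thesis
    by (rule finite_subset) (simp add: finite_PiE)
qed

text \<open>
Pick one point of \<open>X\<close> in every cell that meets \<open>X\<close>; such a point is within the diameter of the cell of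
every other point of \<open>X\<close> in it.
\<close>

lemma obtain_grid_points:
  fixes X :: "'a::euclidean_space set"
  assumes R: "0 < R" and "bounded X"
  obtains P where "P \<subseteq> X" "finite P" "inj_on (grid_cell R) P" "X \<subseteq> (\<Union>p\<in>P. cball p (DIM('a) / R))"
proof -
  obtain P where P: "P \<subseteq> X" "inj_on (grid_cell R) P" "grid_cell R ` X = grid_cell R ` P"
    using subset_image_inj [of "grid_cell R ` X" "grid_cell R" X] by auto
  have "finite P"
    using finite_imageD [of "grid_cell R" P] finite_grid_cell_image [OF assms] P by simp
  moreover have "X \<subseteq> (\<Union>p\<in>P. cball p (DIM('a) / R))"
  proof
    fix x assume "x \<in> X"
    then obtain p where "p \<in> P" "grid_cell R p = grid_cell R x"
      using P(3) by (metis imageE imageI)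
    then show "x \<in> (\<Union>p\<in>P. cball p (DIM('a) / R))"
      using norm_diff_le_if_same_grid_cell [OF R] by (auto simp: dist_norm)
  qed
  ultimately show ?thesis using that P by blast
qed

lemma covering_number_le:
  fixes X :: "'a::euclidean_space set"
  assumes "0 < r" "finite P" "X \<subseteq> (\<Union>p\<in>P. cball p (r / 2))"
  shows "covering_number r X \<le> card P"
proof -
  have "covering_number r X \<le> card ((\<lambda>p. cball p (r / 2)) ` P)"
    unfolding covering_number_def
    by (rule Least_le) (use assms in \<open>auto intro!: exI [of _ "(\<lambda>p. cball p (r / 2)) ` P"]\<close>)
  also have "\<dots> \<le> card P"
    using \<open>finite P\<close> by (rule card_image_le)
  finally show ?thesis .
qed

text \<open>
A finite cover by sets of the prescribed diameter exists, by balls around grid points, so that the least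
cardinality is not an unspecified number.
\<close>

lemma covering_number_attained:
  fixes X :: "'a::euclidean_space set"
  assumes r: "0 < r" and "bounded X"
  obtains \<C> where "finite \<C>" "card \<C> = covering_number r X" "\<And>U. U \<in> \<C> \<Longrightarrow> bounded U"
    "\<And>U. U \<in> \<C> \<Longrightarrow> diameter U = r" "X \<subseteq> \<Union>\<C>"
proof -
  define R where "R = 2 * DIM('a) / r"
  have R: "0 < R" "DIM('a) / R = r / 2"
    using r by (simp_all add: R_def)
  obtain P where P: "finite P" "X \<subseteq> (\<Union>p\<in>P. cball p (r / 2))"
    using obtain_grid_points [OF R(1) \<open>bounded X\<close>] R(2) by metis
  let ?cover = "\<lambda>n \<C>. finite \<C> \<and> card \<C> = n \<and>
    (\<forall>U\<in>\<C>. bounded U \<and> diameter U = r) \<and> X \<subseteq> \<Union>\<C>"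
  have "\<exists>n \<C>. ?cover n \<C>"
    using P r by (intro exI [of _ "card ((\<lambda>p. cball p (r / 2)) ` P)"] exI [of _ "(\<lambda>p. cball p (r / 2)) ` P"]) auto
  then have "\<exists>\<C>. ?cover (covering_number r X) \<C>"
    unfolding covering_number_def by (rule LeastI_ex)
  then show ?thesis using that by blast
qed

lemma covering_number_ge_1:
  fixes X :: "'a::euclidean_space set"
  assumes "0 < r" "bounded X" "X \<noteq> {}"
  shows "1 \<le> covering_number r X"
proof -
  obtain \<C> where "finite \<C>" "card \<C> = covering_number r X" "X \<subseteq> \<Union>\<C>"
    using covering_number_attained [OF assms(1,2)] by metis
  moreover from this have "\<C> \<noteq> {}" using \<open>X \<noteq> {}\<close> by auto
  ultimately show ?thesis by (metis One_nat_def Suc_leI card_gt_0_iff)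
qed

section \<open>Lower bound for the energy\<close>

text \<open>
The complement of the support is a union of open null sets, and countably many of them suffice by
second countability.
\<close>

lemma Compl_superset_spt_null:
  fixes \<mu> :: "'a::second_countable_topology measure"
  assumes s: "sets \<mu> = sets borel" and "spt \<mu> \<subseteq> K"
  shows "\<exists>N\<in>null_sets \<mu>. - K \<subseteq> N"
proof -
  define \<U> where "\<U> = {U. open U \<and> emeasure \<mu> U = 0}"
  obtain \<V> where \<V>: "\<V> \<subseteq> \<U>" "countable \<V>" "\<Union>\<V> = \<Union>\<U>"
    by (rule Lindelof [of \<U>]) (auto simp: \<U>_def)
  have "(\<Union>U\<in>\<V>. U) \<in> null_sets \<mu>"
    using \<V> s by (intro null_sets_UN' null_setsI) (auto simp: \<U>_def)
  moreover have "- K \<subseteq> \<Union>\<U>"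
    using \<open>spt \<mu> \<subseteq> K\<close> by (auto simp: spt_def \<U>_def zero_less_iff_neq_zero)
  ultimately show ?thesis using \<V>(3) by auto
qed

text \<open>
For a partition into \<open>n\<close> sets \<open>Q i\<close> the probability that two independent points share a part is the sum of
the squares of \<open>measure \<mu> (Q i)\<close>, which is at least \<open>1 / n\<close> by the Cauchy-Schwarz inequality. A cover
is first refined to a partition.
\<close>

lemma pair_measure_diagonal_blocks_ge:
  assumes "prob_space \<mu>" and [measurable]: "\<And>i. i < n \<Longrightarrow> A i \<in> sets \<mu>"
    and full: "measure \<mu> (\<Union>i<n. A i) = 1"
  shows "1 \<le> real n * measure (\<mu> \<Otimes>\<^sub>M \<mu>) (\<Union>i<n. A i \<times> A i)"
proof -
  interpret M: prob_space \<mu> by fact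
  interpret MM: pair_prob_space \<mu> \<mu> ..
  define Q where "Q = disjointed A"
  have [measurable]: "Q i \<in> sets \<mu>" if "i < n" for i
    unfolding Q_def disjointed_def using that by auto
  have disj: "disjoint_family_on Q {..<n}"
    using disjoint_family_disjointed [of A] by (auto simp: Q_def disjoint_family_on_def)
  have disj2: "disjoint_family_on (\<lambda>i. Q i \<times> Q i) {..<n}"
    using disj by (auto simp: disjoint_family_on_def)
  have "(\<Union>i<n. Q i) = (\<Union>i<n. A i)"
    using finite_UN_disjointed_eq [of A n] by (simp add: Q_def atLeast0LessThan)
  then have "1 = (\<Sum>i<n. measure \<mu> (Q i))\<^sup>2"
    using full M.finite_measure_finite_Union [of "{..<n}" Q] disj by (auto simp: image_subset_iff)
  also have "\<dots> \<le> (\<Sum>i<n. (measure \<mu> (Q i))\<^sup>2) * real n"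
    using sum_squared_le_sum_of_squares [of "\<lambda>i. measure \<mu> (Q i)" "{..<n}"] by simp
  also have "(\<Sum>i<n. (measure \<mu> (Q i))\<^sup>2) = (\<Sum>i<n. measure (\<mu> \<Otimes>\<^sub>M \<mu>) (Q i \<times> Q i))"
    by (intro sum.cong refl)
      (simp add: measure_def M.emeasure_pair_measure_Times enn2real_mult power2_eq_square)
  also have "\<dots> = measure (\<mu> \<Otimes>\<^sub>M \<mu>) (\<Union>i<n. Q i \<times> Q i)"
    by (rule MM.finite_measure_finite_Union [symmetric]) (use disj2 in auto)
  also have "\<dots> \<le> measure (\<mu> \<Otimes>\<^sub>M \<mu>) (\<Union>i<n. A i \<times> A i)"
    by (rule MM.finite_measure_mono) (use disjointed_subset [of A] in \<open>auto simp: Q_def\<close>)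
  finally show ?thesis by (simp add: mult.commute mult_right_mono)
qed

text \<open>
The cube lies in the ball of radius \<open>R / 2\<close>, so all phases \<open>2 * pi * (w \<bullet> u)\<close> are at most \<open>pi / 3\<close> in
absolute value and their cosines at least \<open>1 / 2\<close>.
\<close>

lemma norm_fourier_cube_measure_ge_half:
  fixes w :: "'a::euclidean_space" and R :: real
  assumes R: "0 < R" and w: "norm w \<le> 1 / (3 * R)"
  shows "1 / 2 \<le> norm (measure_fourier (cube_measure (R / (2 * DIM('a)))) w)"
proof -
  define h where "h = R / (2 * DIM('a))"
  have h: "0 < h" using R by (simp add: h_def)
  interpret N: prob_space "cube_measure h :: 'a measure"
    by (rule prob_space_cube_measure [OF h])
  have int: "integrable (cube_measure h) (character w)"
    by (rule integrable_character [OF N.prob_space_axioms]) (auto intro: measurable_ident_sets)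
  have "1 / 2 = (LINT u|(cube_measure h :: 'a measure). (1 / 2 :: real))"
    by (simp add: N.prob_space)
  also have "\<dots> \<le> (LINT u|cube_measure h. Re (character w u))"
  proof (rule integral_mono_AE)
    show "AE u in cube_measure h. 1 / 2 \<le> Re (character w u)"
      using AE_cube_measure [OF h]
    proof eventually_elim
      fix u :: 'a assume "u \<in> cube h"
      then have "(\<Sum>b\<in>Basis. \<bar>u \<bullet> b\<bar>) \<le> (\<Sum>b\<in>(Basis::'a set). h)"
        by (intro sum_mono) (simp add: mem_cube)
      then have "norm u \<le> R / 2"
        using norm_le_l1 [of u] by (simp add: h_def)
      then have "\<bar>w \<bullet> u\<bar> \<le> 1 / (3 * R) * (R / 2)"
        using w by (intro order_trans [OF Cauchy_Schwarz_ineq2] mult_mono) (use R in auto)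
      then have "\<bar>2 * pi * (w \<bullet> u)\<bar> \<le> pi / 3"
        using R by (simp add: abs_mult field_simps)
      then have "cos (pi / 3) \<le> cos \<bar>2 * pi * (w \<bullet> u)\<bar>"
        by (intro cos_monotone_0_pi_le) auto
      then show "1 / 2 \<le> Re (character w u)"
        by (simp add: Re_character cos_60)
    qed
  qed (use int in auto)
  also have "\<dots> = Re (measure_fourier (cube_measure h) w)"
    unfolding measure_fourier_character by (rule integral_Re [OF int])
  also have "\<dots> \<le> norm (measure_fourier (cube_measure h) w)"
    by (rule complex_Re_le_cmod)
  finally show ?thesis by (simp add: h_def)
qed

text \<open>
Two points in a common set of an optimal cover are at distance at most \<open>1 / (3 * R)\<close>, where the Fejer
kernel is at least \<open>1 / 4\<close>. The sets of the cover are replaced by their closures, which have the same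
diameters and are measurable.
\<close>

lemma fourier_energy_ge_covering_number:
  fixes X :: "'a::euclidean_space set" and R :: real
  assumes R: "0 < R" and X: "bounded X" and \<mu>: "\<mu> \<in> borel_probs_on X"
  shows "(R / DIM('a)) ^ DIM('a) / 4 \<le> covering_number (1 / (3 * R)) X *
    (LINT z:cball 0 R|lborel. (norm (measure_fourier \<mu> z))\<^sup>2)"
proof -
  \<comment> \<open>The side \<open>R / d\<close> is the largest for which the sum of the coordinates bounds differences by \<open>R\<close>.\<close>
  define h where "h = R / (2 * DIM('a))"
  have h: "0 < h" "2 * h * DIM('a) \<le> R" "2 * h = R / DIM('a)"
    using R by (simp_all add: h_def)
  have "0 < 1 / (3 * R)" using R by simp
  from covering_number_attained [OF this X] obtain \<C> where \<C>: "finite \<C>"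
    "card \<C> = covering_number (1 / (3 * R)) X" "\<And>U. U \<in> \<C> \<Longrightarrow> bounded U"
    "\<And>U. U \<in> \<C> \<Longrightarrow> diameter U = 1 / (3 * R)" "X \<subseteq> \<Union>\<C>"
    by metis
  define n where "n = card \<C>"
  obtain B where B: "bij_betw B {..<n} \<C>"
    using ex_bij_betw_nat_finite [OF \<C>(1)] by (auto simp: n_def atLeast0LessThan)
  define A where "A i = closure (B i)" for i
  have \<mu>': "prob_space \<mu>" "sets \<mu> = sets borel" "spt \<mu> \<subseteq> X"
    using \<mu> by (auto simp: borel_probs_on_def)
  define \<nu> :: "'a measure" where "\<nu> = cube_measure h"
  have \<nu>: "prob_space \<nu>" "sets \<nu> = sets borel"
    using h by (simp_all add: \<nu>_def prob_space_cube_measure)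
  interpret M: prob_space \<mu> by fact
  interpret MM: pair_prob_space \<mu> \<mu> ..
  note [measurable] = borel_measurable_measure_fourier [OF \<mu>'(1,2)] borel_measurable_measure_fourier [OF \<nu>]
  note [measurable_cong] = \<mu>'(2)
  have A[measurable]: "A i \<in> sets \<mu>" for i
    unfolding \<mu>'(2) A_def by simp
  have "spt \<mu> \<subseteq> (\<Union>i<n. B i)"
    using \<mu>'(3) \<C>(5) B by (auto simp: bij_betw_def)
  also have "\<dots> \<subseteq> (\<Union>i<n. A i)"
    unfolding A_def by (intro UN_mono order_refl closure_subset)
  finally obtain N where "N \<in> null_sets \<mu>" "- (\<Union>i<n. A i) \<subseteq> N"
    using Compl_superset_spt_null [OF \<mu>'(2)] by blast
  then have "AE x in \<mu>. x \<in> (\<Union>i<n. A i)"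
    by (intro AE_I' [of N]) auto
  then have "measure \<mu> (\<Union>i<n. A i) = 1"
    by (subst M.prob_eq_1) auto
  then have "1 \<le> real n * measure (\<mu> \<Otimes>\<^sub>M \<mu>) (\<Union>i<n. A i \<times> A i)"
    by (intro pair_measure_diagonal_blocks_ge \<mu>' A)
  also have "measure (\<mu> \<Otimes>\<^sub>M \<mu>) (\<Union>i<n. A i \<times> A i)
      = (\<integral>q. indicator (\<Union>i<n. A i \<times> A i) q \<partial>(\<mu> \<Otimes>\<^sub>M \<mu>))"
    by simp
  also have "\<dots> \<le> (\<integral>q. 4 * (norm (measure_fourier \<nu> (fst q - snd q)))\<^sup>2 \<partial>(\<mu> \<Otimes>\<^sub>M \<mu>))"
  proof (rule integral_mono)
    show "integrable (\<mu> \<Otimes>\<^sub>M \<mu>) (\<lambda>q. 4 * (norm (measure_fourier \<nu> (fst q - snd q)))\<^sup>2)"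
      by (rule MM.integrable_const_bound [where B = 4])
        (use norm_measure_fourier_le_1 [OF \<nu>] in \<open>auto intro!: power_le_one\<close>)
    show "integrable (\<mu> \<Otimes>\<^sub>M \<mu>) (indicator (\<Union>i<n. A i \<times> A i) :: _ \<Rightarrow> real)"
      by (rule MM.integrable_const_bound [where B = 1]) (auto split: split_indicator)
    fix q :: "'a \<times> 'a"
    show "indicator (\<Union>i<n. A i \<times> A i) q \<le> 4 * (norm (measure_fourier \<nu> (fst q - snd q)))\<^sup>2"
    proof (cases "q \<in> (\<Union>i<n. A i \<times> A i)")
      case True
      then obtain i where i: "i < n" "fst q \<in> A i" "snd q \<in> A i" by auto
      then have "B i \<in> \<C>" using B by (auto simp: bij_betw_def)
      then have "dist (fst q) (snd q) \<le> 1 / (3 * R)"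
        using diameter_bounded_bound [of "A i" "fst q" "snd q"] i \<C>(3,4)
        by (simp add: A_def diameter_closure bounded_closure)
      then have "1 / 2 \<le> norm (measure_fourier \<nu> (fst q - snd q))"
        unfolding \<nu>_def h_def by (intro norm_fourier_cube_measure_ge_half R) (simp add: dist_norm)
      then have "(1 / 2)\<^sup>2 \<le> (norm (measure_fourier \<nu> (fst q - snd q)))\<^sup>2"
        by (rule power_mono) simp
      then show ?thesis using True by (simp add: power2_eq_square)
    qed simp
  qed
  also have "\<dots> = 4 * (\<integral>p. (norm (measure_fourier \<mu> (fst p - snd p)))\<^sup>2 \<partial>(\<nu> \<Otimes>\<^sub>M \<nu>))"
    using fourier_energy_duality [OF \<mu>'(1,2) \<nu>] by simp
  also have "(\<integral>p. (norm (measure_fourier \<mu> (fst p - snd p)))\<^sup>2 \<partial>(\<nu> \<Otimes>\<^sub>M \<nu>))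
      \<le> (LINT z:cball 0 R|lborel. (norm (measure_fourier \<mu> z))\<^sup>2) / (2 * h) ^ DIM('a)"
    unfolding \<nu>_def using h norm_measure_fourier_le_1 [OF \<mu>'(1,2)]
    by (intro cube_measure_difference_le_ball) (auto intro!: power_le_one)
  finally have "1 \<le> real n * (4 * ((LINT z:cball 0 R|lborel. (norm (measure_fourier \<mu> z))\<^sup>2)
      / (R / DIM('a)) ^ DIM('a)))"
    unfolding h(3) by (simp add: mult_left_mono)
  then show ?thesis
    using R \<C>(2) by (simp add: n_def field_simps)
qed

section \<open>Minimal energy and covering numbers\<close>

lemma exists_fourier_energy_le_covering_number:
  "\<exists>C::real>0. \<forall>R>0. \<forall>X::'a::euclidean_space set. bounded X \<and> X \<noteq> {} \<longrightarrow>
    (\<exists>\<mu>\<in>borel_probs_on X. covering_number (2 * DIM('a) / R) X *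
      (LINT z:cball 0 R|lborel. (norm (measure_fourier \<mu> z))\<^sup>2) \<le> C * R ^ DIM('a))"
proof -
  obtain C :: real where C: "0 < C" and energy: "\<And>R P. 0 < R \<Longrightarrow>
      finite (P :: 'a set) \<Longrightarrow> P \<noteq> {} \<Longrightarrow> inj_on (grid_cell R) P \<Longrightarrow>
      (LINT z:cball 0 R|lborel. (norm (measure_fourier (uniform_points P) z))\<^sup>2)
        \<le> C * R ^ DIM('a) / card P"
    using fourier_energy_separated_points_le [where 'a = 'a] by blast
  show ?thesis
  proof (intro exI [of _ C] conjI C allI impI)
    fix R :: real and X :: "'a set"
    assume R: "0 < R" and X: "bounded X \<and> X \<noteq> {}"
    obtain P where P: "P \<subseteq> X" "finite P" "inj_on (grid_cell R) P"
        "X \<subseteq> (\<Union>p\<in>P. cball p (DIM('a) / R))"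
      using obtain_grid_points [OF R] X by metis
    have "P \<noteq> {}" using P(4) X by auto
    let ?I = "LINT z:cball 0 R|lborel. (norm (measure_fourier (uniform_points P) z))\<^sup>2"
    have "covering_number (2 * DIM('a) / R) X \<le> card P"
      using P R by (intro covering_number_le) auto
    moreover have "0 \<le> ?I"
      by (auto intro!: integral_nonneg simp: set_lebesgue_integral_def)
    ultimately have "covering_number (2 * DIM('a) / R) X * ?I \<le> card P * ?I"
      by (intro mult_right_mono) auto
    also have "\<dots> \<le> card P * (C * R ^ DIM('a) / card P)"
      using energy [OF R P(2) \<open>P \<noteq> {}\<close> P(3)] by (intro mult_left_mono) auto
    also have "\<dots> = C * R ^ DIM('a)"
      using P(2) \<open>P \<noteq> {}\<close> by simp
    finally show "\<exists>\<mu>\<in>borel_probs_on X. covering_number (2 * DIM('a) / R) X *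
        (LINT z:cball 0 R|lborel. (norm (measure_fourier \<mu> z))\<^sup>2) \<le> C * R ^ DIM('a)"
      using uniform_points_in_borel_probs_on [OF P(2) \<open>P \<noteq> {}\<close> P(1)] by blast
  qed
qed

definition min_fourier_energy :: "'a::euclidean_space set \<Rightarrow> real \<Rightarrow> real" where
  "min_fourier_energy X R =
    (INF \<mu>\<in>borel_probs_on X. LINT z:cball 0 R|lborel. (norm (measure_fourier \<mu> z))\<^sup>2)"

lemma min_fourier_energy_covering_number:
  fixes X :: "'a::euclidean_space set"
  assumes X: "bounded X" "X \<noteq> {}"
  obtains c C :: real where "0 < c" "0 < C"
    and "\<And>R. 0 < R \<Longrightarrow> c * R ^ DIM('a) \<le> covering_number (1 / (3 * R)) X * min_fourier_energy X R"
    and "\<And>R. 0 < R \<Longrightarrow> covering_number (2 * DIM('a) / R) X * min_fourier_energy X R \<le> C * R ^ DIM('a)"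
proof -
  define c where "c = (1 / DIM('a)) ^ DIM('a) / 4"
  let ?I = "\<lambda>\<mu> R. LINT z:cball 0 R|lborel. (norm (measure_fourier (\<mu> :: 'a measure) z))\<^sup>2"
  obtain C :: real where C: "0 < C" and up: "\<And>R. 0 < R \<Longrightarrow>
      \<exists>\<mu>\<in>borel_probs_on X. covering_number (2 * DIM('a) / R) X * ?I \<mu> R \<le> C * R ^ DIM('a)"
    using exists_fourier_energy_le_covering_number [where 'a = 'a] X by blast
  show ?thesis
  proof (rule that)
    show "0 < c" by (simp add: c_def)
    show "0 < C" by fact
    fix R :: real assume R: "0 < R"
    obtain \<mu> where \<mu>: "\<mu> \<in> borel_probs_on X"
        "covering_number (2 * DIM('a) / R) X * ?I \<mu> R \<le> C * R ^ DIM('a)"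
      using up [OF R] by blast
    let ?n = "covering_number (1 / (3 * R)) X"
    have n: "0 < ?n"
      using covering_number_ge_1 [of "1 / (3 * R)" X] R X by simp
    have "c * R ^ DIM('a) / ?n \<le> min_fourier_energy X R"
      unfolding min_fourier_energy_def
    proof (rule cINF_greatest)
      show "borel_probs_on X \<noteq> {}" using \<mu>(1) by auto
      show "c * R ^ DIM('a) / ?n \<le> ?I \<mu> R" if "\<mu> \<in> borel_probs_on X" for \<mu>
        using fourier_energy_ge_covering_number [OF R X(1) that] n
        by (simp add: c_def field_simps)
    qed
    then show "c * R ^ DIM('a) \<le> ?n * min_fourier_energy X R"
      using n by (simp add: field_simps)
    have "min_fourier_energy X R \<le> ?I \<mu> R"
      unfolding min_fourier_energy_def
      by (intro cINF_lower bdd_belowI2 [of _ 0] \<mu>)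
        (auto intro!: integral_nonneg simp: set_lebesgue_integral_def)
    then have "covering_number (2 * DIM('a) / R) X * min_fourier_energy X R
        \<le> covering_number (2 * DIM('a) / R) X * ?I \<mu> R"
      by (intro mult_left_mono) auto
    with \<mu>(2) show "covering_number (2 * DIM('a) / R) X * min_fourier_energy X R \<le> C * R ^ DIM('a)"
      by linarith
  qed
qed

text \<open>
Rescaling by the constants \<open>3\<close> and \<open>2 * d\<close> stays within the ranges of the two scales: \<open>R \<ge> 1\<close> gives
\<open>1 / (3 * R) < 1\<close>, and \<open>r < 1\<close> gives \<open>2 * d / r \<ge> 1\<close>.
\<close>

lemma covering_number_upper_iff_energy_lower:
  fixes X :: "'a::euclidean_space set"
  assumes X: "bounded X" "X \<noteq> {}"
  shows "(\<exists>c>0. \<forall>r\<in>{0<..<1}. real (covering_number r X) \<le> c * r powr (- \<beta>)) \<longleftrightarrow>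
    (\<exists>c>0. \<forall>R\<ge>1. min_fourier_energy X R \<ge> c * R powr (real DIM('a) - \<beta>))"
    (is "?covering \<longleftrightarrow> ?energy")
proof -
  let ?d = "real DIM('a)"
  obtain c C :: real where c: "0 < c" and C: "0 < C"
    and lo: "\<And>R. 0 < R \<Longrightarrow> c * R ^ DIM('a) \<le> covering_number (1 / (3 * R)) X * min_fourier_energy X R"
    and up: "\<And>R. 0 < R \<Longrightarrow> covering_number (2 * DIM('a) / R) X * min_fourier_energy X R \<le> C * R ^ DIM('a)"
    using min_fourier_energy_covering_number [OF X] by metis
  show ?thesis
  proof
    assume ?covering
    then obtain k where k: "0 < k"
      and n: "\<And>r. 0 < r \<Longrightarrow> r < 1 \<Longrightarrow> covering_number r X \<le> k * r powr (- \<beta>)" by auto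
    show ?energy
    proof (intro exI [of _ "c / (k * 3 powr \<beta>)"] conjI allI impI)
      show "0 < c / (k * 3 powr \<beta>)" using c k by simp
      fix R :: real assume R: "1 \<le> R"
      let ?J = "min_fourier_energy X R"
      have "0 < c * R ^ DIM('a)" using c R by simp
      also note lo [of R]
      finally have J: "0 < ?J" using R by (simp add: zero_less_mult_iff)
      have "covering_number (1 / (3 * R)) X \<le> k * (1 / (3 * R)) powr (- \<beta>)"
        using R by (intro n) auto
      also have "(1 / (3 * R)) powr (- \<beta>) = 3 powr \<beta> * R powr \<beta>"
        using R by (simp add: powr_minus_divide powr_divide powr_mult)
      finally have "covering_number (1 / (3 * R)) X * ?J \<le> k * (3 powr \<beta> * R powr \<beta>) * ?J"
        using J by (intro mult_right_mono) auto
      with lo [of R] R have "c * R ^ DIM('a) \<le> k * (3 powr \<beta> * R powr \<beta>) * ?J" by linarith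
      then show "c / (k * 3 powr \<beta>) * R powr (?d - \<beta>) \<le> ?J"
        using R k by (simp add: powr_diff powr_realpow field_simps)
    qed
  next
    assume ?energy
    then obtain k where k: "0 < k"
      and J: "\<And>R. 1 \<le> R \<Longrightarrow> k * R powr (?d - \<beta>) \<le> min_fourier_energy X R" by auto
    show ?covering
    proof (intro exI [of _ "C / k * (2 * ?d) powr \<beta>"] conjI ballI)
      show "0 < C / k * (2 * ?d) powr \<beta>" using C k by simp
      fix r :: real assume "r \<in> {0<..<1}"
      then have r: "0 < r" "r < 1" by auto
      define R where "R = 2 * ?d / r"
      have "1 * r \<le> 2 * ?d" using r DIM_ge_Suc0 [where 'a = 'a] by linarith
      then have R: "1 \<le> R" "2 * ?d / R = r"
        using r by (simp_all add: R_def)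
      have "covering_number r X * (k * R powr (?d - \<beta>)) \<le> covering_number r X * min_fourier_energy X R"
        using J R by (intro mult_left_mono) auto
      also have "\<dots> \<le> C * R ^ DIM('a)"
        using up [of R] R by simp
      finally have "covering_number r X \<le> C / k * R powr \<beta>"
        using R k by (simp add: powr_diff powr_realpow field_simps)
      also have "R powr \<beta> = (2 * ?d) powr \<beta> * r powr (- \<beta>)"
        using r by (simp add: R_def powr_divide powr_minus_divide)
      finally show "covering_number r X \<le> C / k * (2 * ?d) powr \<beta> * r powr (- \<beta>)"
        by simp
    qed
  qed
qed

text \<open>
Here the rescaled quantities \<open>2 * d / R\<close> and \<open>1 / (3 * r)\<close> may leave the ranges \<open>r < 1\<close> and \<open>R \<ge> 1\<close>.
At those scales \<open>covering_number r X \<ge> 1\<close> is enough, since \<open>\<beta> \<ge> 0\<close>.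
\<close>

lemma covering_number_lower_iff_energy_upper:
  fixes X :: "'a::euclidean_space set"
  assumes X: "bounded X" "X \<noteq> {}" and \<beta>: "0 \<le> \<beta>"
  shows "(\<exists>c>0. \<forall>r\<in>{0<..<1}. real (covering_number r X) \<ge> c * r powr (- \<beta>)) \<longleftrightarrow>
    (\<exists>c>0. \<forall>R\<ge>1. min_fourier_energy X R \<le> c * R powr (real DIM('a) - \<beta>))"
    (is "?covering \<longleftrightarrow> ?energy")
proof -
  let ?d = "real DIM('a)"
  obtain c C :: real where c: "0 < c" and C: "0 < C"
    and lo: "\<And>R. 0 < R \<Longrightarrow> c * R ^ DIM('a) \<le> covering_number (1 / (3 * R)) X * min_fourier_energy X R"
    and up: "\<And>R. 0 < R \<Longrightarrow> covering_number (2 * DIM('a) / R) X * min_fourier_energy X R \<le> C * R ^ DIM('a)"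
    using min_fourier_energy_covering_number [OF X] by metis
  have n1: "1 \<le> real (covering_number r X)" if "0 < r" for r
    using covering_number_ge_1 [OF that X] by simp
  have J0: "0 < min_fourier_energy X R" if R: "0 < R" for R
  proof -
    have "0 < c * R ^ DIM('a)" using c R by simp
    also note lo [OF R]
    finally show ?thesis using R by (simp add: zero_less_mult_iff)
  qed
  have powr_le_1: "s powr (- \<beta>) \<le> 1" if "1 \<le> s" for s :: real
    using that \<beta> by (simp add: powr_minus_divide ge_one_powr_ge_zero)
  show ?thesis
  proof
    assume ?covering
    then obtain k where k: "0 < k"
      and n: "\<And>r. 0 < r \<Longrightarrow> r < 1 \<Longrightarrow> k * r powr (- \<beta>) \<le> covering_number r X" by auto
    have n': "min k 1 * r powr (- \<beta>) \<le> covering_number r X" if r: "0 < r" for r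
    proof (cases "r < 1")
      case True
      have "min k 1 * r powr (- \<beta>) \<le> k * r powr (- \<beta>)"
        by (intro mult_right_mono) auto
      also note n [OF r True]
      finally show ?thesis .
    next
      case False
      have "min k 1 * r powr (- \<beta>) \<le> 1 * 1"
        using False k powr_le_1 by (intro mult_mono) auto
      also have "\<dots> \<le> covering_number r X" using n1 [OF r] by simp
      finally show ?thesis .
    qed
    show ?energy
    proof (intro exI [of _ "C * (2 * ?d) powr \<beta> / min k 1"] conjI allI impI)
      show "0 < C * (2 * ?d) powr \<beta> / min k 1" using C k by simp
      fix R :: real assume R: "1 \<le> R"
      have "min k 1 * (R powr \<beta> / (2 * ?d) powr \<beta>) = min k 1 * (2 * ?d / R) powr (- \<beta>)"
        using R by (simp add: powr_divide powr_minus_divide)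
      also have "\<dots> \<le> covering_number (2 * ?d / R) X"
        using R by (intro n') simp
      finally have "min k 1 * (R powr \<beta> / (2 * ?d) powr \<beta>) * min_fourier_energy X R
          \<le> covering_number (2 * ?d / R) X * min_fourier_energy X R"
        using R J0 [of R] by (intro mult_right_mono) auto
      also have "\<dots> \<le> C * R ^ DIM('a)"
        using up [of R] R by simp
      finally have "min k 1 * (R powr \<beta> / (2 * ?d) powr \<beta>) * min_fourier_energy X R
          \<le> C * R ^ DIM('a)" .
      moreover have "0 < min k 1" using k by simp
      ultimately show "min_fourier_energy X R \<le> C * (2 * ?d) powr \<beta> / min k 1 * R powr (?d - \<beta>)"
        using R by (simp add: powr_diff powr_realpow field_simps)
    qed
  next
    assume ?energy
    then obtain k where k: "0 < k"
      and J: "\<And>R. 1 \<le> R \<Longrightarrow> min_fourier_energy X R \<le> k * R powr (?d - \<beta>)" by auto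
    show ?covering
    proof (intro exI [of _ "min (c / k) 1 * 3 powr (- \<beta>)"] conjI ballI)
      show "0 < min (c / k) 1 * 3 powr (- \<beta>)" using c k by simp
      fix r :: real assume "r \<in> {0<..<1}"
      then have r: "0 < r" "r < 1" by auto
      have "min (c / k) 1 * (3 * r) powr (- \<beta>) \<le> covering_number r X"
      proof (cases "3 * r \<le> 1")
        case True
        define R where "R = 1 / (3 * r)"
        have R: "1 \<le> R" "1 / (3 * R) = r" "3 * r = 1 / R"
          using r True by (simp_all add: R_def)
        have "c * R ^ DIM('a) \<le> covering_number r X * min_fourier_energy X R"
          using lo [of R] R by simp
        also have "\<dots> \<le> covering_number r X * (k * R powr (?d - \<beta>))"
          using J R by (intro mult_left_mono) auto
        finally have "c / k * R powr \<beta> \<le> covering_number r X"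
          using R(1) k by (simp add: powr_diff powr_realpow field_simps)
        moreover have "(3 * r) powr (- \<beta>) = R powr \<beta>"
          using R(1) unfolding R(3) by (simp add: powr_divide powr_minus_divide)
        moreover have "min (c / k) 1 * R powr \<beta> \<le> c / k * R powr \<beta>"
          by (intro mult_right_mono) auto
        ultimately show ?thesis by simp
      next
        case False
        have "min (c / k) 1 * (3 * r) powr (- \<beta>) \<le> 1 * 1"
          using False c k powr_le_1 by (intro mult_mono) auto
        also have "\<dots> \<le> covering_number r X" using n1 [OF r(1)] by simp
        finally show ?thesis .
      qed
      then show "min (c / k) 1 * 3 powr (- \<beta>) * r powr (- \<beta>) \<le> covering_number r X"
        using r by (simp add: powr_mult mult.assoc)
    qed
  qed
qed

theorem proposition4p2:
  fixes X :: "(real ^ 'd) set"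
  assumes "X \<noteq> {}" and "bounded X"
  shows "upper_box_dim X =
      Inf {\<beta>. \<beta> \<ge> 0 \<and> (\<exists>c>0. \<forall>R\<ge>1.
        (INF \<mu>\<in>borel_probs_on X. LINT z:cball 0 R|lborel. (norm (measure_fourier \<mu> z))\<^sup>2)
          \<ge> c * R powr (real CARD('d) - \<beta>))}
    \<and> lower_box_dim X =
      Sup {\<beta>. \<beta> \<ge> 0 \<and> (\<exists>c>0. \<forall>R\<ge>1.
        (INF \<mu>\<in>borel_probs_on X. LINT z:cball 0 R|lborel. (norm (measure_fourier \<mu> z))\<^sup>2)
          \<le> c * R powr (real CARD('d) - \<beta>))}"
proof -
  have "DIM(real ^ 'd) = CARD('d)" by simp
  note iffs = covering_number_upper_iff_energy_lower [OF assms(2,1), unfolded this min_fourier_energy_def]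
    covering_number_lower_iff_energy_upper [OF assms(2,1), unfolded this min_fourier_energy_def]
  show ?thesis
    unfolding upper_box_dim_def lower_box_dim_def
    by (intro conjI arg_cong [where f = Inf] arg_cong [where f = Sup] Collect_cong conj_cong refl iffs)
qed

end
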